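(* Let $n=n(x)\in\mathbb{Z}$ and suppose $nx^{-1/2}\to c$ for some constant $c\ge0$ as $x\to\infty$. Then $$\sqrt x\,e^{-x}I_n(x)\to(2\pi)^{-1/2}e^{-c^2/2}\quad\text{as }x\to\infty .$$
   Context: $I_n(x)$ denotes the modified Bessel function of the first kind of integer order $n$ and argument $x>0$. The order $n$ may be fixed (then $c=0$) or vary with $x$. *)

theory Defs
  imports "HOL-Analysis.Analysis"
begin

text \<open>
  The modified Bessel function of the first kind of integer order, by its usual power series
  \<open>I\<^sub>n(x) = \<Sum>k. (x/2)\<^bsup>2k+n\<^esup> / (k! \<Gamma>(n+k+1))\<close>. For negative \<open>n\<close> the finitely many terms
  with \<open>n + k + 1 \<le> 0\<close> vanish, since the reciprocal Gamma function \<^const>\<open>rGamma\<close> is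
  zero at the nonpositive integers.
\<close>

definition bessel_I :: "int \<Rightarrow> real \<Rightarrow> real" where
  "bessel_I n x =
     (\<Sum>k. (x / 2) powi (2 * int k + n) * rGamma (of_int (n + int k + 1)) / fact k)"

end

theory Submission
  imports Defs "HOL-Probability.Probability" "HOL-Real_Asymp.Real_Asymp"
begin

text \<open>
  The integral representation
  \<open>2\<pi> I\<^sub>n(x) = \<integral>\<^bsub>-\<pi>\<^esub>\<^bsup>\<pi>\<^esup> exp(i n t) exp(x cos t) dt\<close> (\<open>bessel_I_integral\<close>)
  turns the claim into Laplace's method. For large \<open>x\<close> the weight \<open>exp(x (cos t - 1))\<close>
  concentrates around \<open>t = 0\<close> on the scale \<open>1/sqrt x\<close>, which is exactly the scale on which
  \<open>exp(i n t)\<close> oscillates when \<open>n\<close> has order \<open>sqrt x\<close>. Substituting \<open>t = s / sqrt x\<close>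
  absorbs the factor \<open>sqrt x\<close>, and the integrand becomes
  \<open>exp(i (n / sqrt x) s) exp(x (cos(s / sqrt x) - 1))\<close>, which tends pointwise to
  \<open>exp(i c s) exp(- s\<^sup>2 / 2)\<close>. Since \<open>1 - cos t\<close> is bounded below by a multiple of \<open>t\<^sup>2\<close> on
  \<open>[-\<pi>, \<pi>]\<close> (\<open>cos_le_quadratic\<close>), a Gaussian dominates all these integrands and the limit may
  be taken under the integral (\<open>scaled_integral_tendsto\<close>). The limiting integral is the
  characteristic function of the standard normal distribution, up to normalisation.

  The representation follows from
  \<open>exp(x cos t) = exp((x/2) exp(i t)) exp((x/2) exp(-i t))\<close>: expanding the first factor in powers
  leaves Fourier coefficients of the second one, which are \<open>(x/2)\<^bsup>m\<^esup> / m!\<close> for \<open>m \<ge> 0\<close> and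
  vanish for \<open>m < 0\<close>, just as the reciprocal Gamma function does in the series of \<open>I\<^sub>n\<close>.
\<close>

section \<open>The integral representation of the Bessel function\<close>

text \<open>
  The Weierstrass criterion suffices here because the interval has finite measure, so that
  the integrated majorants are still summable.
\<close>

lemma set_integral_sums:
  fixes f :: "nat \<Rightarrow> real \<Rightarrow> complex"
  assumes cont: "\<And>k. continuous_on {a..b} (f k)"
    and bound: "\<And>k t. t \<in> {a..b} \<Longrightarrow> norm (f k t) \<le> B k"
    and B: "summable B"
  shows "(\<lambda>k. LINT t:{a..b}|lborel. f k t) sums (LINT t:{a..b}|lborel. (\<Sum>k. f k t))"
proof -
  let ?g = "\<lambda>k t. indicator {a..b} t *\<^sub>R f k t"
  have int: "integrable lborel (?g k)" for k
    using borel_integrable_atLeastAtMost'[OF cont] by (simp add: set_integrable_def)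
  have intB: "integrable lborel (\<lambda>t. indicator {a..b} t * B k)" for k
    by (intro integrable_mult_left integrable_real_indicator) (auto simp: emeasure_lborel_Icc_eq)
  have norm_g: "norm (?g k t) \<le> indicator {a..b} t * B k" for k t
    using bound[of t k] by (auto simp: indicator_def)
  have "(\<lambda>k. integral\<^sup>L lborel (?g k)) sums (LINT t|lborel. (\<Sum>k. ?g k t))"
  proof (rule sums_integral)
    show "integrable lborel (?g k)" for k by (rule int)
    have "summable (\<lambda>k. norm (?g k t))" for t
    proof (rule summable_comparison_test')
      show "summable (\<lambda>k. indicator {a..b} t * B k)"
        by (intro summable_mult B)
    qed (use norm_g in auto)
    thus "AE t in lborel. summable (\<lambda>k. norm (?g k t))" by simp
    show "summable (\<lambda>k. LINT t|lborel. norm (?g k t))"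
    proof (rule summable_comparison_test')
      show "summable (\<lambda>k. measure lborel {a..b} * B k)"
        by (intro summable_mult B)
      show "norm (LINT t|lborel. norm (?g k t)) \<le> measure lborel {a..b} * B k" for k
      proof -
        have "(LINT t|lborel. norm (?g k t)) \<le> (LINT t|lborel. indicator {a..b} t * B k)"
          by (intro integral_mono integrable_norm int intB norm_g)
        also have "\<dots> = measure lborel {a..b} * B k" by simp
        finally show ?thesis by (simp add: integral_nonneg_AE)
      qed
    qed
  qed
  moreover have "(\<Sum>k. ?g k t) = indicator {a..b} t *\<^sub>R (\<Sum>k. f k t)" for t
    by (auto simp: indicator_def)
  ultimately show ?thesis by (simp add: set_lebesgue_integral_def)
qed

lemma integral_cis_period:
  "(LINT t:{-pi..pi}|lborel. cis (of_int m * t)) = (if m = 0 then 2 * pi else 0)"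
proof (cases "m = 0")
  case True
  thus ?thesis by (simp add: set_lebesgue_integral_def scaleR_conv_of_real)
next
  case False
  let ?F = "\<lambda>t. cis (of_int m * t) / (\<i> * of_int m)"
  have "(LINT t:{-pi..pi}|lborel. cis (of_int m * t)) = ?F pi - ?F (-pi)"
    unfolding set_lebesgue_integral_def
  proof (rule integral_FTC_Icc)
    show "(?F has_vector_derivative cis (of_int m * t)) (at t within {-pi..pi})" for t
      unfolding cis_conv_exp using False
      by (auto intro!: derivative_eq_intros has_vector_derivative_real_field simp: field_simps)
    show "continuous_on {-pi..pi} (\<lambda>t. cis (of_int m * t))"
      by (intro continuous_intros)
  qed simp
  also have "cis (of_int m * pi) = cis (of_int m * (-pi))"
    by (auto simp: complex_eq_iff sin_zero_iff_int2)
  hence "?F pi - ?F (-pi) = 0" by simp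
  finally show ?thesis using False by simp
qed

text \<open>
  The function \<open>exp(y exp(-i t))\<close> has only nonpositive frequencies, and the one at \<open>-k\<close> has
  amplitude \<open>y\<^bsup>k\<^esup> / k!\<close>; integrating against \<open>exp(i m t)\<close> picks out \<open>k = m\<close>.
\<close>

lemma cis_exp_fourier_coefficient:
  fixes y :: real and m :: int
  shows "(LINT t:{-pi..pi}|lborel. cis (of_int m * t) * exp (y * cis (-t)))
     = 2 * pi * (if m \<ge> 0 then y ^ nat m / fact (nat m) else 0)"
proof -
  let ?f = "\<lambda>k t. of_real (y ^ k / fact k) * cis (of_int (m - int k) * t)"
  have series: "(\<Sum>k. ?f k t) = cis (of_int m * t) * exp (y * cis (-t))" for t
  proof -
    have "(\<lambda>k. (y * cis (-t)) ^ k /\<^sub>R fact k) sums exp (y * cis (-t))"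
      by (rule exp_converges)
    hence "(\<lambda>k. cis (of_int m * t) * ((y * cis (-t)) ^ k /\<^sub>R fact k))
        sums (cis (of_int m * t) * exp (y * cis (-t)))"
      by (rule sums_mult)
    moreover have "cis (of_int m * t) * ((y * cis (-t)) ^ k /\<^sub>R fact k) = ?f k t" for k
      by (simp add: power_mult_distrib Complex.DeMoivre scaleR_conv_of_real cis_mult field_simps flip: cis_divide)
    ultimately show ?thesis by (simp add: sums_iff)
  qed
  have "(\<lambda>k. LINT t:{-pi..pi}|lborel. ?f k t) sums (LINT t:{-pi..pi}|lborel. (\<Sum>k. ?f k t))"
  proof (rule set_integral_sums)
    show "continuous_on {-pi..pi} (?f k)" for k by (intro continuous_intros)
    show "norm (?f k t) \<le> \<bar>y\<bar> ^ k / fact k" for k t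
      by (simp add: norm_mult norm_divide norm_power)
    show "summable (\<lambda>k. \<bar>y\<bar> ^ k / fact k)"
      using summable_exp[of "\<bar>y\<bar>"] by (simp add: field_simps)
  qed
  hence lhs: "(\<lambda>k. LINT t:{-pi..pi}|lborel. ?f k t) sums
      (LINT t:{-pi..pi}|lborel. cis (of_int m * t) * exp (y * cis (-t)))"
    by (simp only: series)
  have term_eq: "(LINT t:{-pi..pi}|lborel. ?f k t) =
      (if k = nat m then of_real (2 * pi * (if m \<ge> 0 then y ^ nat m / fact (nat m) else 0)) else 0)" for k
    unfolding set_integral_mult_right integral_cis_period by auto
  have "(\<lambda>k. LINT t:{-pi..pi}|lborel. ?f k t) sums
      of_real (2 * pi * (if m \<ge> 0 then y ^ nat m / fact (nat m) else 0))"
    unfolding term_eq by (rule sums_single)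
  with lhs show ?thesis by (simp add: sums_iff)
qed

text \<open>
  Only the factor \<open>exp((x/2) exp(i t))\<close> is expanded. Its \<open>k\<close>-th term shifts the frequency from
  \<open>n\<close> to \<open>n + k\<close>, so the Fourier coefficient of the remaining factor contributes
  \<open>(x/2)\<^bsup>n+k\<^esup> / (n+k)!\<close>, or \<open>0\<close> if \<open>n + k < 0\<close>: together with \<open>(x/2)\<^bsup>k\<^esup> / k!\<close> this is the
  \<open>k\<close>-th term of the series of \<open>I\<^sub>n\<close>, for either sign of \<open>n\<close>.
\<close>

lemma bessel_I_integral:
  fixes n :: int and x :: real
  assumes "x > 0"
  shows "(LINT t:{-pi..pi}|lborel. cis (of_int n * t) * exp (x * cos t)) = 2 * pi * bessel_I n x"
proof -
  define y where "y = x / 2"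
  have y: "y > 0" using assms by (simp add: y_def)
  let ?f = "\<lambda>k t. of_real (y ^ k / fact k) * (cis (of_int (n + int k) * t) * exp (y * cis (-t)))"
  let ?b = "\<lambda>k. y powi (2 * int k + n) * rGamma (of_int (n + int k + 1)) / fact k"
  have series: "(\<Sum>k. ?f k t) = cis (of_int n * t) * exp (x * cos t)" for t
  proof -
    have "(\<lambda>k. (y * cis t) ^ k /\<^sub>R fact k) sums exp (y * cis t)"
      by (rule exp_converges)
    hence "(\<lambda>k. cis (of_int n * t) * exp (y * cis (-t)) * ((y * cis t) ^ k /\<^sub>R fact k))
        sums (cis (of_int n * t) * exp (y * cis (-t)) * exp (y * cis t))"
      by (rule sums_mult)
    moreover have "cis (of_int n * t) * exp (y * cis (-t)) * ((y * cis t) ^ k /\<^sub>R fact k) = ?f k t" for k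
      by (simp add: power_mult_distrib Complex.DeMoivre scaleR_conv_of_real distrib_right field_simps flip: cis_mult)
    moreover have "exp (y * cis (-t)) * exp (y * cis t) = exp (x * cos t)"
    proof -
      have "y * cis (-t) + y * cis t = complex_of_real (x * cos t)"
        by (simp add: y_def complex_eq_iff)
      thus ?thesis by (simp flip: exp_add exp_of_real)
    qed
    ultimately show ?thesis by (simp add: sums_iff mult.assoc)
  qed
  have "(\<lambda>k. LINT t:{-pi..pi}|lborel. ?f k t) sums (LINT t:{-pi..pi}|lborel. (\<Sum>k. ?f k t))"
  proof (rule set_integral_sums)
    show "continuous_on {-pi..pi} (?f k)" for k by (intro continuous_intros)
    show "norm (?f k t) \<le> y ^ k / fact k * exp y" for k t
    proof -
      have "norm (exp (y * cis (-t))) \<le> exp y"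
        using norm_exp[of "y * cis (-t)"] y by (simp add: norm_mult)
      thus ?thesis using y
        by (simp add: norm_mult norm_divide norm_power field_simps)
    qed
    show "summable (\<lambda>k. y ^ k / fact k * exp y)"
      using summable_exp[of y] by (intro summable_mult2) (simp add: field_simps)
  qed
  hence "(\<lambda>k. LINT t:{-pi..pi}|lborel. ?f k t) sums
      (LINT t:{-pi..pi}|lborel. cis (of_int n * t) * exp (x * cos t))"
    by (simp only: series)
  moreover have "(LINT t:{-pi..pi}|lborel. ?f k t) = of_real (2 * pi * ?b k)" for k
  proof (cases "n + int k \<ge> 0")
    case True
    have "y powi (2 * int k + n) = y powi (int k + int (nat (n + int k)))"
      using True by (intro arg_cong2[where f = "(powi)"]) auto
    also have "\<dots> = y ^ k * y ^ nat (n + int k)"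
      using y by (subst power_int_add) (auto simp only: power_int_of_nat)
    finally have power: "y powi (2 * int k + n) = y ^ k * y ^ nat (n + int k)" .
    show ?thesis
      unfolding set_integral_mult_right cis_exp_fourier_coefficient rGamma_of_int power using True
      by (simp add: field_simps)
  next
    case False
    thus ?thesis
      unfolding set_integral_mult_right cis_exp_fourier_coefficient rGamma_of_int by simp
  qed
  ultimately have sums: "(\<lambda>k. complex_of_real (2 * pi * ?b k)) sums
      (LINT t:{-pi..pi}|lborel. cis (of_int n * t) * exp (x * cos t))"
    by (simp only:)
  \<comment> \<open>The convergence just obtained also shows that the defining series of the Bessel function is
    summable, without which the value of its infinite sum would be unspecified.\<close>
  have "(\<lambda>k. 2 * pi * ?b k) sums Re (LINT t:{-pi..pi}|lborel. cis (of_int n * t) * exp (x * cos t))"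
    using sums_Re[OF sums] by (simp only: Re_complex_of_real)
  hence "summable ?b"
    by (intro summable_mult_D[of "2 * pi" ?b]) (auto simp only: sums_iff, simp)
  hence "?b sums bessel_I n x"
    by (simp add: bessel_I_def y_def summable_sums)
  hence "(\<lambda>k. complex_of_real (2 * pi * ?b k)) sums of_real (2 * pi * bessel_I n x)"
    by (intro sums_of_real sums_mult)
  from sums_unique2[OF sums this] show ?thesis .
qed

section \<open>Laplace's method\<close>

text \<open>
  The constant \<open>1/18\<close> is far from the optimal \<open>2/\<pi>\<^sup>2\<close>, but any positive one yields an integrable
  majorant. It comes from \<open>1 - cos t = 2 sin\<^sup>2(t/2)\<close> and the Taylor bound
  \<open>\<bar>sin u - u\<bar> \<le> \<bar>u\<bar>\<^sup>3 / 6\<close>, which for \<open>\<bar>u\<bar> \<le> 2\<close> gives \<open>\<bar>sin u\<bar> \<ge> \<bar>u\<bar> / 3\<close>.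
\<close>

lemma cos_le_quadratic:
  fixes t :: real
  assumes "\<bar>t\<bar> \<le> pi"
  shows "cos t \<le> 1 - t\<^sup>2 / 18"
proof -
  define u where "u = t / 2"
  have u: "\<bar>u\<bar> \<le> 2" using assms pi_less_4 by (simp add: u_def)
  have "\<bar>sin u - u\<bar> \<le> \<bar>u\<bar> ^ 3 / 6"
    using Maclaurin_sin_bound[of u 3] by (simp add: numeral_3_eq_3 sin_coeff_def fact_numeral)
  also have "\<bar>u\<bar> ^ 3 = \<bar>u\<bar> * \<bar>u\<bar>\<^sup>2" by (simp add: power3_eq_cube power2_eq_square)
  also have "\<bar>u\<bar> * \<bar>u\<bar>\<^sup>2 / 6 \<le> \<bar>u\<bar> * 2\<^sup>2 / 6"
    by (intro divide_right_mono mult_left_mono power_mono u) auto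
  also have "\<dots> = 2 / 3 * \<bar>u\<bar>" by simp
  finally have "\<bar>u\<bar> / 3 \<le> \<bar>sin u\<bar>" by linarith
  hence "(\<bar>u\<bar> / 3)\<^sup>2 \<le> \<bar>sin u\<bar>\<^sup>2" by (intro power_mono) auto
  moreover have "cos t = 1 - 2 * (sin u)\<^sup>2"
    using cos_double_sin[of u] by (simp add: u_def)
  ultimately show ?thesis by (simp add: u_def power_divide)
qed

text \<open>
  The substitution \<open>t = s / sqrt x\<close>, after which mass and oscillation live on the scale \<open>1\<close>.
\<close>

lemma bessel_I_scaled_integral:
  fixes n :: int and x :: real
  assumes x: "x > 0"
  shows "of_real (2 * pi * (sqrt x * exp (- x) * bessel_I n x)) =
    (LINT s:{-pi * sqrt x..pi * sqrt x}|lborel.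
       cis (of_int n / sqrt x * s) * exp (x * (cos (s / sqrt x) - 1)))"
proof -
  define r where "r = sqrt x"
  have r: "r > 0" using x by (simp add: r_def)
  let ?f = "\<lambda>t. indicator {-pi..pi} t *\<^sub>R (cis (of_int n * t) * exp (x * cos t))"
  let ?g = "\<lambda>s. indicator {-pi * r..pi * r} s *\<^sub>R
      (cis (of_int n / r * s) * exp (x * (cos (s / r) - 1)))"
  have "complex_of_real (2 * pi * bessel_I n x) = \<bar>1 / r\<bar> *\<^sub>R (LINT s|lborel. ?f (0 + 1 / r * s))"
    using bessel_I_integral[OF x, of n] lborel_integral_real_affine[of "1 / r" ?f 0] r
    by (simp add: set_lebesgue_integral_def)
  also have "?f (0 + 1 / r * s) = complex_of_real (exp x) * ?g s" for s
  proof -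
    have "indicator {-pi..pi} (s / r) = (indicator {-pi * r..pi * r} s :: real)"
      using r by (auto simp: indicator_def field_simps)
    thus ?thesis
      by (simp add: algebra_simps exp_diff flip: exp_of_real)
  qed
  hence "(LINT s|lborel. ?f (0 + 1 / r * s)) = exp x * (LINT s|lborel. ?g s)"
    by (simp only: integral_mult_right_zero)
  finally have "complex_of_real (2 * pi * bessel_I n x)
      = \<bar>1 / r\<bar> *\<^sub>R (exp x * (LINT s|lborel. ?g s))" .
  hence "(LINT s|lborel. ?g s) = of_real (2 * pi * (r * exp (- x) * bessel_I n x))"
    using r by (simp add: scaleR_conv_of_real field_simps exp_minus)
  thus ?thesis by (simp add: set_lebesgue_integral_def r_def)
qed

lemma integral_cis_gaussian:
  "(LINT s|lborel. cis (c * s) * exp (- s\<^sup>2 / 2)) = complex_of_real (sqrt (2 * pi) * exp (- c\<^sup>2 / 2))"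
proof -
  have "complex_of_real (exp (- c\<^sup>2 / 2)) = (LINT s|std_normal_distribution. iexp (c * s))"
    using char_std_normal_distribution[THEN fun_cong, of c] by (simp add: char_def)
  also have "\<dots> = (LINT s|lborel. std_normal_density s *\<^sub>R iexp (c * s))"
    by (subst integral_density) auto
  also have "\<dots> = (LINT s|lborel. (1 / sqrt (2 * pi)) * (cis (c * s) * exp (- s\<^sup>2 / 2)))"
    by (intro Bochner_Integration.integral_cong refl)
       (simp add: std_normal_density_def cis_conv_exp scaleR_conv_of_real flip: exp_of_real)
  also have "\<dots> = (1 / sqrt (2 * pi)) * (LINT s|lborel. (cis (c * s) * exp (- s\<^sup>2 / 2)))"
    by (rule integral_mult_right_zero)
  finally show ?thesis by (simp add: field_simps flip: exp_of_real)
qed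

text \<open>
  Dominated convergence with majorant \<open>exp(- s\<^sup>2 / 18)\<close>. The frequency \<open>a\<close> is an arbitrary
  convergent real function, since the oscillating factor has modulus \<open>1\<close> whatever \<open>a\<close> is.
\<close>

lemma scaled_integral_tendsto:
  fixes a :: "real \<Rightarrow> real"
  assumes a: "(a \<longlongrightarrow> c) at_top"
  shows "((\<lambda>x. LINT s:{-pi * sqrt x..pi * sqrt x}|lborel.
       cis (a x * s) * exp (x * (cos (s / sqrt x) - 1)))
     \<longlongrightarrow> complex_of_real (sqrt (2 * pi) * exp (- c\<^sup>2 / 2))) at_top"
  unfolding integral_cis_gaussian[symmetric] set_lebesgue_integral_def
proof (rule integral_dominated_convergence_at_top)
  let ?h = "\<lambda>x s. indicator {-pi * sqrt x..pi * sqrt x} s *\<^sub>R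
      (cis (a x * s) * exp (x * (cos (s / sqrt x) - 1)))"
  have [measurable]: "(\<lambda>s. cis (b * s)) \<in> borel_measurable borel" for b
    by (intro borel_measurable_continuous_onI continuous_intros)
  show "(\<lambda>s. cis (c * s) * exp (- s\<^sup>2 / 2)) \<in> borel_measurable lborel"
    by measurable
  show "?h x \<in> borel_measurable lborel" for x
    by measurable
  \<comment> \<open>The majorant is an unnormalised Gaussian of variance \<open>9\<close>.\<close>
  have "integrable lborel (\<lambda>s. sqrt (2 * pi * 3\<^sup>2) * normal_density 0 3 s)"
    by simp
  thus "integrable lborel (\<lambda>s::real. exp (- s\<^sup>2 / 18))"
    by (simp add: normal_density_def)
  show "\<forall>\<^sub>F x in at_top. AE s in lborel. norm (?h x s) \<le> exp (- s\<^sup>2 / 18)"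
    using eventually_gt_at_top[of 0]
  proof eventually_elim
    case (elim x)
    have "norm (?h x s) \<le> exp (- s\<^sup>2 / 18)" for s
    proof (cases "s \<in> {-pi * sqrt x..pi * sqrt x}")
      case True
      hence "\<bar>s / sqrt x\<bar> \<le> pi" using elim by (simp add: field_simps abs_le_iff)
      from cos_le_quadratic[OF this] have "x * (cos (s / sqrt x) - 1) \<le> x * (- (s / sqrt x)\<^sup>2 / 18)"
        using elim by (intro mult_left_mono) auto
      also have "\<dots> = - s\<^sup>2 / 18" using elim by (simp add: power_divide)
      finally show ?thesis using True by (simp add: norm_mult)
    qed simp
    thus ?case by simp
  qed
  show "AE s in lborel. ((\<lambda>x. ?h x s) \<longlongrightarrow> cis (c * s) * exp (- s\<^sup>2 / 2)) at_top"
  proof (intro AE_I2)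
    fix s :: real
    have "((\<lambda>x. x * (cos (s / sqrt x) - 1)) \<longlongrightarrow> - s\<^sup>2 / 2) at_top"
      by (real_asymp simp: power2_eq_square)
    hence "((\<lambda>x. cis (a x * s) * exp (x * (cos (s / sqrt x) - 1)))
        \<longlongrightarrow> cis (c * s) * complex_of_real (exp (- s\<^sup>2 / 2))) at_top"
      unfolding cis_conv_exp by (intro tendsto_intros a)
    moreover have "\<forall>\<^sub>F x in at_top. \<bar>s\<bar> \<le> pi * sqrt x"
      by real_asymp
    hence "\<forall>\<^sub>F x in at_top. cis (a x * s) * exp (x * (cos (s / sqrt x) - 1)) = ?h x s"
      by eventually_elim (auto simp: indicator_def)
    ultimately show "((\<lambda>x. ?h x s) \<longlongrightarrow> cis (c * s) * exp (- s\<^sup>2 / 2)) at_top"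
      by (rule Lim_transform_eventually)
  qed
qed

lemma powr_neg_half:
  fixes x :: real
  assumes "x > 0"
  shows "x powr (-1/2) = 1 / sqrt x"
  using powr_minus_divide[of x "1/2"] powr_half_sqrt[of x] assms by simp

theorem proposition8p2:
  fixes n :: "real \<Rightarrow> int" and c :: real
  assumes "c \<ge> 0"
    and "((\<lambda>x. of_int (n x) * x powr (-1/2)) \<longlongrightarrow> c) at_top"
  shows "((\<lambda>x. sqrt x * exp (- x) * bessel_I (n x) x)
           \<longlongrightarrow> (2 * pi) powr (-1/2) * exp (- (c\<^sup>2) / 2)) at_top"
proof -
  let ?L = "\<lambda>x. sqrt x * exp (- x) * bessel_I (n x) x"
  have "\<forall>\<^sub>F x in at_top. of_int (n x) * x powr (-1/2) = of_int (n x) / sqrt x"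
    using eventually_gt_at_top[of 0]
    by eventually_elim (simp only: powr_neg_half, simp)
  hence "((\<lambda>x. of_int (n x) / sqrt x) \<longlongrightarrow> c) at_top"
    by (rule Lim_transform_eventually[OF assms(2)])
  note scaled_integral_tendsto[OF this]
  moreover have "\<forall>\<^sub>F x in at_top. (LINT s:{-pi * sqrt x..pi * sqrt x}|lborel.
       cis (of_int (n x) / sqrt x * s) * exp (x * (cos (s / sqrt x) - 1))) = complex_of_real (2 * pi * ?L x)"
    using eventually_gt_at_top[of 0]
    by eventually_elim (simp only: bessel_I_scaled_integral)
  ultimately have "((\<lambda>x. complex_of_real (2 * pi * ?L x))
      \<longlongrightarrow> of_real (sqrt (2 * pi) * exp (- c\<^sup>2 / 2))) at_top"
    by (rule Lim_transform_eventually)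
  hence "((\<lambda>x. 2 * pi * ?L x) \<longlongrightarrow> sqrt (2 * pi) * exp (- c\<^sup>2 / 2)) at_top"
    by (simp only: tendsto_of_real_iff)
  hence "((\<lambda>x. 2 * pi * ?L x / (2 * pi)) \<longlongrightarrow> sqrt (2 * pi) * exp (- c\<^sup>2 / 2) / (2 * pi)) at_top"
    by (intro tendsto_divide tendsto_const) auto
  moreover have "sqrt (2 * pi) / (2 * pi) = (2 * pi) powr (-1/2)"
    using powr_neg_half[of "2 * pi"] sqrt_divide_self_eq[of "2 * pi"] by (simp add: inverse_eq_divide)
  ultimately show ?thesis by (simp add: field_simps)
qed

end
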